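(* Let $m\ge 2$, let $E$ be a finite set, and let $(E,\mathcal{F}_1),\dots,(E,\mathcal{F}_m)$ be matroids with rank functions $r_1,\dots,r_m$ respectively. Assume that $(E,\bigcap_{i=1}^k\mathcal{F}_i)$ is a matroid for every $k=2,3,\dots,m$. Then $$\max\Bigl\{|S| : S\in\bigcap_{i=1}^m\mathcal{F}_i\Bigr\}=\min\bigl\{r_1(X)+r_2(X_1\setminus X)+\dots+r_{m-1}(X_{m-2}\setminus X_{m-3})+r_m(E\setminus X_{m-2})\bigr\},$$ where the minimum is taken over all chains of subsets $X\subseteq X_1\subseteq X_2\subseteq\dots\subseteq X_{m-2}\subseteq E$, with the convention $X_0=X$ (so for $m=2$ the right-hand side is $\min\{r_1(X)+r_2(E\setminus X): X\subseteq E\}$).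
   Context: A matroid is a pair $(E,\mathcal{F})$ with $E$ a finite set and $\mathcal{F}\subseteq 2^E$ such that: (M1) $\emptyset\in\mathcal{F}$; (M2) if $X\subseteq Y\in\mathcal{F}$ then $X\in\mathcal{F}$; (M3) if $X,Y\in\mathcal{F}$ and $|X|>|Y|$ then there is $x\in X\setminus Y$ with $Y\cup\{x\}\in\mathcal{F}$. Its rank function is $r(X)=\max\{|Y|: Y\subseteq X,\ Y\in\mathcal{F}\}$ for $X\subseteq E$. *)

theory Defs
  imports Main
begin

definition matroid :: "'a set \<Rightarrow> 'a set set \<Rightarrow> bool" where
  "matroid E F \<longleftrightarrow>
     finite E \<and> F \<subseteq> Pow E \<and>
     {} \<in> F \<and>
     (\<forall>X Y. X \<subseteq> Y \<and> Y \<in> F \<longrightarrow> X \<in> F) \<and>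
     (\<forall>X Y. X \<in> F \<and> Y \<in> F \<and> card X > card Y \<longrightarrow> (\<exists>x \<in> X - Y. insert x Y \<in> F))"

definition rank :: "'a set set \<Rightarrow> 'a set \<Rightarrow> nat" where
  "rank F X = Max {card Y | Y. Y \<subseteq> X \<and> Y \<in> F}"

text \<open>Only the values \<open>X 0, \<dots>, X (m - 2)\<close> matter in the next two definitions; they
  represent the chain \<open>X = X\<^sub>0 \<subseteq> X\<^sub>1 \<subseteq> \<dots> \<subseteq> X\<^sub>m\<^sub>-\<^sub>2 \<subseteq> E\<close>. Both are meant for \<open>m \<ge> 2\<close>.\<close>

definition subset_chain :: "'a set \<Rightarrow> nat \<Rightarrow> (nat \<Rightarrow> 'a set) \<Rightarrow> bool" where
  "subset_chain E m X \<longleftrightarrow> (\<forall>i \<in> {1..m - 2}. X (i - 1) \<subseteq> X i) \<and> X (m - 2) \<subseteq> E"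

definition chain_value :: "'a set \<Rightarrow> nat \<Rightarrow> (nat \<Rightarrow> 'a set set) \<Rightarrow> (nat \<Rightarrow> 'a set) \<Rightarrow> nat" where
  "chain_value E m F X =
     rank (F 1) (X 0) + (\<Sum>i = 1..m - 2. rank (F (i + 1)) (X i - X (i - 1)))
       + rank (F m) (E - X (m - 2))"

end

(* By induction on m. The base case is Edmonds' matroid intersection theorem. For the step from m to
   m + 1, apply it to the matroid formed by the intersection of the first m families and to the last
   matroid; this produces the top set of the chain, and the rank of that set in the first matroid
   expands by the induction hypothesis.

   The intersection theorem is proved by deletion and contraction of an element e that is a loop in
   neither matroid: if both smaller instances fail to give a common independent set of size k,
   submodularity combines their two witnesses into a set X with r1(X) + r2(E - X) < k. *)
theory Submission
  imports Defs "HOL-Library.FuncSet"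
begin

section \<open>Rank and basis extension\<close>

lemma card_le_rank:
  assumes "finite A" "I \<in> F" "I \<subseteq> A"
  shows "card I \<le> rank F A"
proof -
  have "finite {card Y | Y. Y \<subseteq> A \<and> Y \<in> F}"
    by (rule finite_subset[of _ "card ` Pow A"]) (use assms(1) in auto)
  then show ?thesis
    unfolding rank_def using assms by (intro Max_ge) auto
qed

lemma rank_attained:
  assumes "finite A" "{} \<in> F"
  obtains I where "I \<in> F" "I \<subseteq> A" "card I = rank F A"
proof -
  have "finite {card Y | Y. Y \<subseteq> A \<and> Y \<in> F}"
    by (rule finite_subset[of _ "card ` Pow A"]) (use assms(1) in auto)
  moreover have "{card Y | Y. Y \<subseteq> A \<and> Y \<in> F} \<noteq> {}"
    using assms(2) by auto
  ultimately have "rank F A \<in> {card Y | Y. Y \<subseteq> A \<and> Y \<in> F}"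
    unfolding rank_def by (rule Max_in)
  then show ?thesis using that by auto
qed

lemma matroid_finite: "matroid E F \<Longrightarrow> finite E"
  and matroid_subset: "matroid E F \<Longrightarrow> I \<in> F \<Longrightarrow> I \<subseteq> E"
  and matroid_empty: "matroid E F \<Longrightarrow> {} \<in> F"
  and matroid_mono: "matroid E F \<Longrightarrow> I \<in> F \<Longrightarrow> J \<subseteq> I \<Longrightarrow> J \<in> F"
  unfolding matroid_def by blast+

lemma matroid_finite_indep: "matroid E F \<Longrightarrow> I \<in> F \<Longrightarrow> finite I"
  by (meson matroid_finite matroid_subset finite_subset)

lemma matroid_augment:
  assumes "matroid E F" "I \<in> F" "J \<in> F" "card J < card I"
  obtains x where "x \<in> I - J" "insert x J \<in> F"
  using assms unfolding matroid_def by blast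

text \<open>Augmenting from a fixed maximum independent subset \<open>B\<close> of \<open>A\<close>
  never leaves \<open>A\<close> and closes the gap \<open>rank F A - card I\<close> by one each
  time.\<close>

lemma extend_to_basis:
  assumes M: "matroid E F" and "A \<subseteq> E" "I \<in> F" "I \<subseteq> A"
  obtains J where "J \<in> F" "I \<subseteq> J" "J \<subseteq> A" "card J = rank F A"
proof -
  have fA: "finite A"
    using M \<open>A \<subseteq> E\<close> by (metis matroid_finite finite_subset)
  have "\<exists>J. J \<in> F \<and> I \<subseteq> J \<and> J \<subseteq> A \<and> card J = rank F A"
    using assms(3,4)
  proof (induction "rank F A - card I" arbitrary: I)
    case 0
    then show ?case using card_le_rank[OF fA, of I F] by force
  next
    case (Suc n)
    obtain B where B: "B \<in> F" "B \<subseteq> A" "card B = rank F A"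
      using rank_attained fA matroid_empty[OF M] by metis
    with Suc.hyps(2) obtain x where x: "x \<in> B - I" "insert x I \<in> F"
      using matroid_augment[OF M B(1) Suc.prems(1)] by force
    have "finite I" using Suc.prems fA finite_subset by blast
    then have "n = rank F A - card (insert x I)" using Suc.hyps(2) x by simp
    then show ?case using Suc.hyps(1)[of "insert x I"] x B Suc.prems by blast
  qed
  then show ?thesis using that by blast
qed

text \<open>A basis \<open>I\<close> of \<open>A \<inter> B\<close> extends to a basis
  \<open>J\<close> of \<open>A \<union> B\<close>. The traces of \<open>J\<close> on
  \<open>A\<close> and \<open>B\<close> are independent, cover \<open>J\<close>, and both contain
  \<open>I\<close>, so their sizes sum to at least \<open>card I + card J\<close>.\<close>

lemma rank_submodular:
  assumes M: "matroid E F" and AB: "A \<subseteq> E" "B \<subseteq> E"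
  shows "rank F (A \<inter> B) + rank F (A \<union> B) \<le> rank F A + rank F B"
proof -
  have fin: "finite A" "finite B"
    using M AB by (meson matroid_finite finite_subset)+
  obtain I where I: "I \<in> F" "I \<subseteq> A \<inter> B" "card I = rank F (A \<inter> B)"
    using rank_attained[of "A \<inter> B" F] fin matroid_empty[OF M] by blast
  obtain J where J: "J \<in> F" "I \<subseteq> J" "J \<subseteq> A \<union> B" "card J = rank F (A \<union> B)"
    using extend_to_basis[OF M, of "A \<union> B" I] I AB by blast
  have fJ: "finite J" using J fin finite_subset by blast
  have "card I + card J \<le> card ((J \<inter> A) \<inter> (J \<inter> B)) + card ((J \<inter> A) \<union> (J \<inter> B))"
  proof -
    have "card I \<le> card ((J \<inter> A) \<inter> (J \<inter> B))"
      using I J fJ by (intro card_mono) auto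
    moreover have "(J \<inter> A) \<union> (J \<inter> B) = J" using J by blast
    ultimately show ?thesis by simp
  qed
  also have "\<dots> = card (J \<inter> A) + card (J \<inter> B)"
    using card_Un_Int[of "J \<inter> A" "J \<inter> B"] fJ by simp
  also have "\<dots> \<le> rank F A + rank F B"
    using matroid_mono[OF M J(1)] fin by (intro add_mono card_le_rank) auto
  finally show ?thesis using I J by simp
qed

section \<open>Restriction and contraction\<close>

lemma rank_restrict: "A \<subseteq> Y \<Longrightarrow> rank {I \<in> F. I \<subseteq> Y} A = rank F A"
  unfolding rank_def by (rule arg_cong[where f = Max]) blast

lemma matroid_restrict:
  assumes M: "matroid E F" and Y: "Y \<subseteq> E"
  shows "matroid Y {I \<in> F. I \<subseteq> Y}"
  unfolding matroid_def
proof (intro conjI allI impI)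
  show "finite Y" using matroid_finite[OF M] Y finite_subset by blast
  show "{} \<in> {I \<in> F. I \<subseteq> Y}" using matroid_empty[OF M] by blast
next
  fix I J assume *: "I \<in> {I \<in> F. I \<subseteq> Y} \<and> J \<in> {I \<in> F. I \<subseteq> Y} \<and> card J < card I"
  then obtain x where "x \<in> I - J" "insert x J \<in> F"
    using matroid_augment[OF M, of I J] by blast
  then show "\<exists>x\<in>I - J. insert x J \<in> {I \<in> F. I \<subseteq> Y}" using * by blast
qed (use matroid_mono[OF M] in blast)+

text \<open>Putting \<open>e\<close> back into both sets preserves the comparison of sizes, and the
  augmenting element found there cannot be \<open>e\<close>. That \<open>e\<close> is not a loop
  makes the empty set independent.\<close>

lemma matroid_contract:
  assumes M: "matroid E F" and e: "{e} \<in> F"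
  shows "matroid (E - {e}) {I. e \<notin> I \<and> insert e I \<in> F}"
  unfolding matroid_def
proof (intro conjI allI impI)
  show "finite (E - {e})" using matroid_finite[OF M] by simp
  show "{I. e \<notin> I \<and> insert e I \<in> F} \<subseteq> Pow (E - {e})" using matroid_subset[OF M] by blast
  show "{} \<in> {I. e \<notin> I \<and> insert e I \<in> F}" using e by simp
next
  fix I J assume "I \<subseteq> J \<and> J \<in> {I. e \<notin> I \<and> insert e I \<in> F}"
  then show "I \<in> {I. e \<notin> I \<and> insert e I \<in> F}"
    using matroid_mono[OF M, of "insert e J" "insert e I"] by auto
next
  fix I J assume *: "I \<in> {I. e \<notin> I \<and> insert e I \<in> F} \<and> J \<in> {I. e \<notin> I \<and> insert e I \<in> F}
    \<and> card J < card I"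
  then have IJ: "insert e I \<in> F" "insert e J \<in> F" "e \<notin> I" "e \<notin> J" "card J < card I"
    by auto
  then have "finite I" "finite J"
    using matroid_finite_indep[OF M] by (metis finite_insert)+
  with IJ have "card (insert e J) < card (insert e I)" by simp
  then obtain x where "x \<in> insert e I - insert e J" "insert x (insert e J) \<in> F"
    using matroid_augment[OF M IJ(1,2)] by blast
  then show "\<exists>x\<in>I - J. insert x J \<in> {I. e \<notin> I \<and> insert e I \<in> F}"
    using IJ(4) by (intro bexI[of _ x]) (auto simp: insert_commute)
qed

text \<open>A basis of \<open>insert e A\<close> can be chosen to contain \<open>e\<close>, by
  extending \<open>{e}\<close>; without \<open>e\<close> it is independent in the
  contraction.\<close>

lemma rank_contract:
  assumes M: "matroid E F" and e: "{e} \<in> F" and A: "A \<subseteq> E"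
  shows "rank F (insert e A) \<le> Suc (rank {I. e \<notin> I \<and> insert e I \<in> F} (A - {e}))"
proof -
  have fA: "finite A" using A matroid_finite[OF M] finite_subset by blast
  have "insert e A \<subseteq> E" using A e matroid_subset[OF M] by blast
  then obtain J where J: "J \<in> F" "{e} \<subseteq> J" "J \<subseteq> insert e A" "card J = rank F (insert e A)"
    using extend_to_basis[OF M _ e, of "insert e A"] by blast
  have "card (J - {e}) \<le> rank {I. e \<notin> I \<and> insert e I \<in> F} (A - {e})"
    using J fA by (intro card_le_rank) (auto simp: insert_absorb)
  then show ?thesis using J by simp
qed

section \<open>The matroid intersection theorem\<close>

lemma rank_eq_0:
  assumes M: "matroid E F" and A: "A \<subseteq> E" and loops: "\<And>x. x \<in> A \<Longrightarrow> {x} \<notin> F"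
  shows "rank F A = 0"
proof -
  have "finite A" using A matroid_finite[OF M] finite_subset by blast
  then obtain I where I: "I \<in> F" "I \<subseteq> A" "card I = rank F A"
    using rank_attained matroid_empty[OF M] by metis
  have "I = {}" using I loops matroid_mono[OF M I(1)] by blast
  then show ?thesis using I by simp
qed

lemma matroid_intersection:
  assumes "matroid E F" "matroid E G"
    and "\<And>X. X \<subseteq> E \<Longrightarrow> k \<le> rank F X + rank G (E - X)"
  shows "\<exists>S \<in> F \<inter> G. k \<le> card S"
  using assms
proof (induction "card E" arbitrary: E F G k rule: less_induct)
  case less
  note F = less.prems(1) and G = less.prems(2) and k = less.prems(3)
  show ?case
  proof (cases "\<exists>e. {e} \<in> F \<inter> G")
    case False
    \<comment> \<open>The loops of \<open>F\<close> form the witness: with no common non-loop,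
      everything outside \<open>?X\<close> is a loop of \<open>G\<close>, so the bound at
      \<open>?X\<close> forces \<open>k = 0\<close>.\<close>
    let ?X = "{x \<in> E. {x} \<notin> F}"
    have "rank F ?X = 0" by (rule rank_eq_0[OF F]) auto
    moreover have "rank G (E - ?X) = 0" by (rule rank_eq_0[OF G]) (use False in auto)
    ultimately have "k = 0" using k[of ?X] by auto
    then show ?thesis using matroid_empty[OF F] matroid_empty[OF G] by auto
  next
    case True
    then obtain e where eF: "{e} \<in> F" and eG: "{e} \<in> G" by blast
    then have eE: "e \<in> E" using matroid_subset[OF F] by blast
    let ?D = "E - {e}"
    have card: "card ?D < card E"
      using eE matroid_finite[OF F] by (intro psubset_card_mono) auto
    show ?thesis
    proof (rule ccontr)
      assume neg: "\<not> ?thesis"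
      \<comment> \<open>Deletion: otherwise the induction hypothesis gives a common independent set
        of size \<open>k\<close> avoiding \<open>e\<close>.\<close>
      have "\<exists>X \<subseteq> ?D. rank F X + rank G (?D - X) < k"
      proof (rule ccontr)
        assume "\<not> ?thesis"
        then have "\<exists>S \<in> {I \<in> F. I \<subseteq> ?D} \<inter> {I \<in> G. I \<subseteq> ?D}. k \<le> card S"
          by (intro less.hyps[OF card] matroid_restrict[OF F] matroid_restrict[OF G])
             (auto simp: rank_restrict not_less)
        then show False using neg by blast
      qed
      then obtain X where X: "X \<subseteq> ?D" "rank F X + rank G (?D - X) < k" by blast
      let ?F = "{I. e \<notin> I \<and> insert e I \<in> F}" and ?G = "{I. e \<notin> I \<and> insert e I \<in> G}"
      \<comment> \<open>Contraction: the target drops to \<open>k - 1\<close> because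
        \<open>e\<close> is added back to the set found.\<close>
      have "\<exists>Y \<subseteq> ?D. rank ?F Y + rank ?G (?D - Y) < k - 1"
      proof (rule ccontr)
        assume "\<not> ?thesis"
        then have "\<exists>S \<in> ?F \<inter> ?G. k - 1 \<le> card S"
          by (intro less.hyps[OF card] matroid_contract F G eF eG) (auto simp: not_less)
        then obtain S where S: "e \<notin> S" "insert e S \<in> F \<inter> G" "k - 1 \<le> card S" by blast
        then have "finite S"
          using matroid_finite_indep[OF F] by (metis IntD1 finite_insert)
        then have "k \<le> card (insert e S)" using S by simp
        then show False using neg S by blast
      qed
      then obtain Y where Y: "Y \<subseteq> ?D" "rank ?F Y + rank ?G (?D - Y) < k - 1" by blast
      have "rank F (insert e Y) \<le> Suc (rank ?F Y)"
        using rank_contract[OF F eF, of Y] Y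
        by (metis Diff_empty Diff_insert0 Diff_subset subset_Diff_insert subset_trans)
      moreover have "rank G (E - Y) \<le> Suc (rank ?G (?D - Y))"
      proof -
        have "insert e (?D - Y) = E - Y" using eE Y by blast
        then show ?thesis using rank_contract[OF G eG, of "?D - Y"] by auto
      qed
      \<comment> \<open>The strict bound by \<open>k - 1\<close> leaves at most
        \<open>k - 2\<close>, and \<open>e\<close> adds at most one on each side.\<close>
      ultimately have *: "rank F (insert e Y) + rank G (E - Y) \<le> k" using Y by linarith
      \<comment> \<open>Submodularity is applied so that the four resulting sets form two
        complementary pairs, \<open>X \<inter> Y\<close> and \<open>insert e (X \<union> Y)\<close>
        with their complements in \<open>E\<close>. The assumed bound makes the total at least
        \<open>2 * k\<close>, while the two witnesses keep it below \<open>2 * k\<close>.\<close>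
      have "rank F (X \<inter> Y) + rank F (insert e (X \<union> Y)) \<le> rank F X + rank F (insert e Y)"
      proof -
        have "X \<inter> insert e Y = X \<inter> Y" "X \<union> insert e Y = insert e (X \<union> Y)" using X by auto
        then show ?thesis using rank_submodular[OF F, of X "insert e Y"] X Y eE by auto
      qed
      moreover have "rank G (E - insert e (X \<union> Y)) + rank G (E - X \<inter> Y)
          \<le> rank G (?D - X) + rank G (E - Y)"
      proof -
        have "(?D - X) \<inter> (E - Y) = E - insert e (X \<union> Y)" "(?D - X) \<union> (E - Y) = E - X \<inter> Y"
          using X Y eE by auto
        then show ?thesis using rank_submodular[OF G, of "?D - X" "E - Y"] by auto
      qed
      moreover have "k \<le> rank F (X \<inter> Y) + rank G (E - X \<inter> Y)"
        using X by (intro k) auto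
      moreover have "k \<le> rank F (insert e (X \<union> Y)) + rank G (E - insert e (X \<union> Y))"
        using X Y eE by (intro k) auto
      ultimately show False using X(2) * by linarith
    qed
  qed
qed

text \<open>The easy half of min-max: \<open>X\<close> splits a largest common independent set into
  a part independent in \<open>F\<close> and a part independent in \<open>G\<close>.\<close>

lemma rank_Int_le:
  assumes "matroid E F" "matroid E G" "Y \<subseteq> E" "X \<subseteq> Y"
  shows "rank (F \<inter> G) Y \<le> rank F X + rank G (Y - X)"
proof -
  have fY: "finite Y" using assms by (meson matroid_finite finite_subset)
  obtain I where I: "I \<in> F \<inter> G" "I \<subseteq> Y" "card I = rank (F \<inter> G) Y"
    using rank_attained[OF fY, of "F \<inter> G"] assms matroid_empty by (metis IntI)
  have "card I = card (I \<inter> X) + card (I - X)"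
    using card_Int_Diff[of I X] I fY finite_subset by blast
  moreover have "card (I \<inter> X) \<le> rank F X"
    using assms I matroid_mono[of E F I "I \<inter> X"] fY finite_subset by (intro card_le_rank) auto
  moreover have "card (I - X) \<le> rank G (Y - X)"
    using assms I matroid_mono[of E G I "I - X"] fY by (intro card_le_rank) auto
  ultimately show ?thesis using I by simp
qed

text \<open>If every \<open>X\<close> failed, the intersection theorem on the restrictions to
  \<open>Y\<close>, with target one above the rank, would give too large a common independent
  set.\<close>

lemma rank_Int_attained:
  assumes F: "matroid E F" and G: "matroid E G" and Y: "Y \<subseteq> E"
  obtains X where "X \<subseteq> Y" "rank F X + rank G (Y - X) \<le> rank (F \<inter> G) Y"
proof (rule ccontr)
  assume "\<not> thesis"
  then have "\<And>X. X \<subseteq> Y \<Longrightarrow> Suc (rank (F \<inter> G) Y) \<le> rank F X + rank G (Y - X)"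
    using that by (meson not_less_eq_eq)
  then obtain S where "S \<in> F \<inter> G" "S \<subseteq> Y" "Suc (rank (F \<inter> G) Y) \<le> card S"
    using matroid_intersection[OF matroid_restrict[OF F Y] matroid_restrict[OF G Y],
        of "Suc (rank (F \<inter> G) Y)"] by (auto simp: rank_restrict)
  moreover have "finite Y" using F Y by (meson matroid_finite finite_subset)
  ultimately show False using card_le_rank[of Y S "F \<inter> G"] by simp
qed

section \<open>Chains and the induction on the number of matroids\<close>

lemma subset_chain_Suc:
  assumes "m \<ge> 2"
  shows "subset_chain Y (Suc m) X \<longleftrightarrow> subset_chain (X (m - 1)) m X \<and> X (m - 1) \<subseteq> Y"
proof -
  obtain n where "m = Suc (Suc n)" using assms by (metis add_2_eq_Suc le_Suc_ex)
  then show ?thesis by (auto simp: subset_chain_def atLeastAtMostSuc_conv)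
qed

text \<open>As for the chain condition, the top set \<open>X (m - 1)\<close> is peeled off and
  becomes the ground set of the shorter chain; so the ground set has to vary in the
  induction.\<close>

lemma chain_value_Suc:
  assumes "m \<ge> 2"
  shows "chain_value Y (Suc m) F X =
    chain_value (X (m - 1)) m F X + rank (F (Suc m)) (Y - X (m - 1))"
proof -
  obtain n where "m = Suc (Suc n)" using assms by (metis add_2_eq_Suc le_Suc_ex)
  then show ?thesis by (simp add: chain_value_def)
qed

lemma subset_chain_cong:
  "(\<And>i. i \<le> m - 2 \<Longrightarrow> X i = X' i) \<Longrightarrow> subset_chain Y m X = subset_chain Y m X'"
  unfolding subset_chain_def by (intro arg_cong2[where f = "(\<and>)"] ball_cong) auto

lemma chain_value_cong:
  "(\<And>i. i \<le> m - 2 \<Longrightarrow> X i = X' i) \<Longrightarrow> chain_value Y m F X = chain_value Y m F X'"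
  unfolding chain_value_def by (auto intro!: sum.cong)

text \<open>The min-max formula for the rank of any \<open>Y \<subseteq> E\<close>, split into a
  bound and its attainment. The general \<open>Y\<close> is needed since the induction hypothesis is
  applied to the top set of the chain.\<close>

lemma rank_INT_chain:
  fixes F :: "nat \<Rightarrow> 'a set set"
  assumes "m \<ge> 2"
    and "\<And>i. i \<in> {1..m} \<Longrightarrow> matroid E (F i)"
    and "\<And>k. k \<in> {2..m} \<Longrightarrow> matroid E (\<Inter>i\<in>{1..k}. F i)"
    and "Y \<subseteq> E"
  shows "(\<forall>X. subset_chain Y m X \<longrightarrow> rank (\<Inter>i\<in>{1..m}. F i) Y \<le> chain_value Y m F X) \<and>
    (\<exists>X. subset_chain Y m X \<and> chain_value Y m F X \<le> rank (\<Inter>i\<in>{1..m}. F i) Y)"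
  using assms
proof (induction m arbitrary: Y rule: nat_induct_at_least)
  case base
  have 12: "matroid E (F 1)" "matroid E (F 2)" using base.prems(1) by auto
  have INT: "(\<Inter>i\<in>{1..2}. F i) = F 1 \<inter> F 2"
    by (auto simp: numeral_2_eq_2 atLeastAtMostSuc_conv)
  obtain X where "X \<subseteq> Y" "rank (F 1) X + rank (F 2) (Y - X) \<le> rank (F 1 \<inter> F 2) Y"
    using rank_Int_attained[OF 12] base.prems by metis
  then have "\<exists>X. subset_chain Y 2 X \<and> chain_value Y 2 F X \<le> rank (\<Inter>i\<in>{1..2}. F i) Y"
    unfolding INT by (intro exI[of _ "\<lambda>_. X"]) (auto simp: subset_chain_def chain_value_def)
  then show ?case
    using rank_Int_le[OF 12] base.prems(3)
    unfolding INT by (auto simp: subset_chain_def chain_value_def)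
next
  case (Suc m)
  let ?G = "\<Inter>i\<in>{1..m}. F i"
  \<comment> \<open>Here the hypothesis on partial intersections enters: the intersection theorem
    requires \<open>?G\<close> to be a matroid.\<close>
  have G: "matroid E ?G" using Suc.prems(2)[of m] Suc.hyps by simp
  have Fm: "matroid E (F (Suc m))" using Suc.prems(1) by simp
  have INT: "(\<Inter>i\<in>{1..Suc m}. F i) = ?G \<inter> F (Suc m)"
    by (auto simp: atLeastAtMostSuc_conv)
  have IH: "(\<forall>X. subset_chain Z m X \<longrightarrow> rank ?G Z \<le> chain_value Z m F X) \<and>
      (\<exists>X. subset_chain Z m X \<and> chain_value Z m F X \<le> rank ?G Z)" if "Z \<subseteq> E" for Z
  proof (rule Suc.IH[OF _ _ that])
    show "matroid E (F i)" if "i \<in> {1..m}" for i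
      using Suc.prems(1)[of i] that by simp
    show "matroid E (\<Inter>i\<in>{1..k}. F i)" if "k \<in> {2..m}" for k
      using Suc.prems(2)[of k] that by simp
  qed
  show ?case
  proof (intro conjI allI impI)
    fix X assume "subset_chain Y (Suc m) X"
    then have X: "subset_chain (X (m - 1)) m X" "X (m - 1) \<subseteq> Y"
      unfolding subset_chain_Suc[OF Suc.hyps] by blast+
    have "rank (?G \<inter> F (Suc m)) Y \<le> rank ?G (X (m - 1)) + rank (F (Suc m)) (Y - X (m - 1))"
      using rank_Int_le[OF G Fm Suc.prems(3) X(2)] .
    also have "rank ?G (X (m - 1)) \<le> chain_value (X (m - 1)) m F X"
      using IH X Suc.prems(3) by blast
    finally show "rank (\<Inter>i\<in>{1..Suc m}. F i) Y \<le> chain_value Y (Suc m) F X"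
      unfolding INT chain_value_Suc[OF Suc.hyps] by simp
  next
    obtain Z where Z: "Z \<subseteq> Y" "rank ?G Z + rank (F (Suc m)) (Y - Z) \<le> rank (?G \<inter> F (Suc m)) Y"
      using rank_Int_attained[OF G Fm Suc.prems(3)] by blast
    then obtain X where X: "subset_chain Z m X" "chain_value Z m F X \<le> rank ?G Z"
      using IH Suc.prems(3) by blast
    \<comment> \<open>The chain below \<open>Z\<close> reads only the indices up to
      \<open>m - 2\<close>, so position \<open>m - 1\<close> is free for the new top set.\<close>
    let ?X = "X(m - 1 := Z)"
    have eq: "X i = ?X i" if "i \<le> m - 2" for i using that Suc.hyps by auto
    have "subset_chain Y (Suc m) ?X"
      using X(1) Z(1) subset_chain_cong[of m X ?X Z] eq
      by (simp add: subset_chain_Suc[OF Suc.hyps])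
    moreover have "chain_value Y (Suc m) F ?X \<le> rank (?G \<inter> F (Suc m)) Y"
      using X(2) Z(2) chain_value_cong[of m X ?X Z F] eq
      by (simp add: chain_value_Suc[OF Suc.hyps])
    ultimately show "\<exists>X. subset_chain Y (Suc m) X
        \<and> chain_value Y (Suc m) F X \<le> rank (\<Inter>i\<in>{1..Suc m}. F i) Y"
      unfolding INT by blast
  qed
qed

text \<open>There may be infinitely many sequences \<open>X\<close>, but the value depends only on
  the restriction to \<open>{..m - 2}\<close>, which ranges over a finite function space.\<close>

lemma finite_chain_values:
  assumes "finite E"
  shows "finite {chain_value E m F X | X. subset_chain E m X}"
proof -
  \<comment> \<open>The chain condition places only the last set inside \<open>E\<close>;
    monotonicity passes this on to the earlier ones.\<close>
  have mono: "X i \<subseteq> X j" if "subset_chain E m X" "i \<le> j" "j \<le> m - 2" for X :: "nat \<Rightarrow> 'a set" and i j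
    using that(2,3)
  proof (induction j rule: dec_induct)
    case (step j)
    then show ?case using that(1) unfolding subset_chain_def
      by (metis One_nat_def Suc_leD Suc_le_mono atLeastAtMost_iff diff_Suc_1 dual_order.trans zero_le)
  qed simp
  let ?P = "PiE {..m - 2} (\<lambda>_. Pow E)"
  have "{chain_value E m F X | X. subset_chain E m X} \<subseteq> chain_value E m F ` ?P"
  proof clarify
    fix X assume X: "subset_chain E m X"
    have "X i \<subseteq> E" if "i \<le> m - 2" for i
      using mono[OF X that] X unfolding subset_chain_def by blast
    then have "restrict X {..m - 2} \<in> ?P" by auto
    moreover have "chain_value E m F X = chain_value E m F (restrict X {..m - 2})"
      by (rule chain_value_cong) simp
    ultimately show "chain_value E m F X \<in> chain_value E m F ` ?P" by blast
  qed
  then show ?thesis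
    using assms by (meson finite_PiE finite_Pow_iff finite_atMost finite_imageI finite_subset)
qed

theorem proposition1p1:
  fixes E :: "'a set" and m :: nat and F :: "nat \<Rightarrow> 'a set set"
  assumes "m \<ge> 2"
    and "finite E"
    and "\<And>i. i \<in> {1..m} \<Longrightarrow> matroid E (F i)"
    and "\<And>k. k \<in> {2..m} \<Longrightarrow> matroid E (\<Inter>i\<in>{1..k}. F i)"
  shows "Max {card S | S. S \<in> (\<Inter>i\<in>{1..m}. F i)} =
         Min {chain_value E m F X | X. subset_chain E m X}"
proof -
  let ?G = "\<Inter>i\<in>{1..m}. F i"
  have "matroid E ?G" using assms(1,4) by simp
  \<comment> \<open>Independent sets lie in \<open>E\<close>, so the maximum over all of them is the
    rank of \<open>E\<close>.\<close>
  then have "{card S | S. S \<in> ?G} = {card S | S. S \<subseteq> E \<and> S \<in> ?G}"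
    using matroid_subset by blast
  then have "Max {card S | S. S \<in> ?G} = rank ?G E"
    unfolding rank_def by (rule arg_cong)
  also have "\<dots> = Min {chain_value E m F X | X. subset_chain E m X}"
  proof (rule Min_eqI[symmetric])
    show "finite {chain_value E m F X | X. subset_chain E m X}"
      by (rule finite_chain_values[OF assms(2)])
  \<comment> \<open>A chain whose value is at most the rank has exactly that value, by the bound
    valid for all chains; so the rank is itself a chain value.\<close>
  qed (use rank_INT_chain[OF assms(1,3,4) subset_refl] in \<open>force intro: antisym\<close>)+
  finally show ?thesis .
qed

end
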